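(* Suppose that for every $\theta_0\in\Theta$ there is a family (indexed by the level $\alpha\in(0,1)$) of nonrandomized uniformly most powerful unbiased (UMPU) level-$\alpha$ tests for $K_0:\theta\le\theta_0$ versus $K_1:\theta>\theta_0$, with corresponding $p$-value $p(\theta_0)=p(\mathbf X_n,\theta_0)$, the infimum of the $\alpha$ at which $K_0$ is rejected. Assume that: 1. for each sample $\mathbf X_n$, $p(\mathbf X_n,\cdot)$ is strictly increasing and continuous as a function of $\theta_0$, with range $[0,1]$ (the endpoints $0$ and $1$ possibly being only limits); 2. for every $\theta_0$, $1-p(\theta_0)$ is the $p$-value (in the same sense) of a family of UMPU tests for $K_0:\theta\ge\theta_0$ versus $K_1:\theta<\theta_0$; 3. for every $\theta_0$, the distribution of $p(\theta_0)$ when $\theta=\theta_0$ is $U[0,1]$. Define the CD $H^*(x)=p(\mathbf X_n,x)$. Then $H^*$ is more precise than any other confidence distribution for $\theta$ (based on the same data), at all $\theta_0\in\Theta$.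
   Context: The data $\mathbf X_n$ take values in a sample space $\mathcal X$ and have a distribution $P_{\theta,\nu}$, where $\theta\in\Theta$ is the parameter of interest, $\Theta\subseteq\mathbb R$ is an interval, and $\nu$ denotes possible nuisance parameters. A function $H(\cdot)=H(\mathbf X_n,\cdot)$ with values in $[0,1]$ is a confidence distribution (CD) for $\theta$ if (i) for each given sample $\mathbf X_n$, $H(\cdot)$ is a continuous cumulative distribution function on $\Theta$ (extended by $0$ to the left and by $1$ to the right of $\Theta$); (ii) for every $\theta_0\in\Theta$, when $\theta=\theta_0$ is the true value (whatever $\nu$), $H(\mathbf X_n,\theta_0)$ has the uniform distribution $U(0,1)$. For random variables $Y_1,Y_2$: $Y_1\overset{\mathrm{sto}}{\le}Y_2$ means $P(Y_1\le s)\ge P(Y_2\le s)$ for all $s$. $H_1$ is more precise than $H_2$ at $\theta=\theta_0$ if for all $\epsilon>0$, when $\theta_0$ is the true value (whatever $\nu$), $H_1(\theta_0-\epsilon)\overset{\mathrm{sto}}{\le}H_2(\theta_0-\epsilon)$ and $1-H_1(\theta_0+\epsilon)\overset{\mathrm{sto}}{\le}1-H_2(\theta_0+\epsilon)$. A level-$\alpha$ test of $K_0$ versus $K_1$ is unbiased if its rejection probability is at most $\alpha$ for every parameter value in $K_0$ and at least $\alpha$ for every parameter value in $K_1$; it is UMPU if at every parameter value in $K_1$ it has rejection probability at least that of any other unbiased level-$\alpha$ test. *)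

theory Defs
  imports "HOL-Probability.Probability"
begin

text \<open>
  Throughout, \<open>S\<close> is the sample space, \<open>\<Theta>\<close> the set of values of the parameter of interest,
  \<open>N \<theta>\<close> the set of values the nuisance parameter can take when \<open>\<theta>\<close> is the true value, and
  \<open>P \<theta> \<nu>\<close> the distribution of the data on \<open>S\<close>. A statistic depending on \<open>\<theta>\<close>, such as
  \<open>H(X, \<theta>)\<close>, is a curried function \<open>H x \<theta>\<close>; only its values at \<open>\<theta> \<in> \<Theta>\<close> matter.
\<close>

definition has_U01 :: "'x measure \<Rightarrow> ('x \<Rightarrow> real) \<Rightarrow> bool" where
  "has_U01 Q Y \<longleftrightarrow>
     Y \<in> borel_measurable Q \<and> distr Q borel Y = uniform_measure lborel {0..1}"

definition sto_le :: "'x measure \<Rightarrow> ('x \<Rightarrow> real) \<Rightarrow> ('x \<Rightarrow> real) \<Rightarrow> bool" where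
  "sto_le Q Y1 Y2 \<longleftrightarrow>
     (\<forall>s. measure Q {x \<in> space Q. Y1 x \<le> s} \<ge> measure Q {x \<in> space Q. Y2 x \<le> s})"

text \<open>Extension of a function on an interval \<open>\<Theta>\<close> by 0 to its left and by 1 to its right.\<close>

definition extend :: "real set \<Rightarrow> (real \<Rightarrow> real) \<Rightarrow> real \<Rightarrow> real" where
  "extend \<Theta> F t = (if t \<in> \<Theta> then F t else if \<forall>\<theta>\<in>\<Theta>. t < \<theta> then 0 else 1)"

text \<open>
  \<open>measure \<mu> \<Theta> = 1\<close> excludes mass at an endpoint that does not belong to \<open>\<Theta>\<close>, i.e. \<open>F\<close> tends
  to 1 towards an open right end. Continuity is required on \<open>\<Theta>\<close> only. In particular the values
  of \<open>F\<close> lie in \<open>[0,1]\<close>.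
\<close>

definition continuous_cdf_on :: "real set \<Rightarrow> (real \<Rightarrow> real) \<Rightarrow> bool" where
  "continuous_cdf_on \<Theta> F \<longleftrightarrow>
     continuous_on \<Theta> F \<and>
     (\<exists>\<mu>. real_distribution \<mu> \<and> measure \<mu> \<Theta> = 1 \<and> extend \<Theta> F = cdf \<mu>)"

definition confidence_distribution ::
  "'x measure \<Rightarrow> real set \<Rightarrow> (real \<Rightarrow> 'n set) \<Rightarrow> (real \<Rightarrow> 'n \<Rightarrow> 'x measure)
     \<Rightarrow> ('x \<Rightarrow> real \<Rightarrow> real) \<Rightarrow> bool" where
  "confidence_distribution S \<Theta> N P H \<longleftrightarrow>
     (\<forall>x\<in>space S. continuous_cdf_on \<Theta> (H x)) \<and>
     (\<forall>\<theta>0\<in>\<Theta>. \<forall>\<nu>\<in>N \<theta>0. has_U01 (P \<theta>0 \<nu>) (\<lambda>x. H x \<theta>0))"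

definition more_precise_at ::
  "real set \<Rightarrow> (real \<Rightarrow> 'n set) \<Rightarrow> (real \<Rightarrow> 'n \<Rightarrow> 'x measure) \<Rightarrow> real
     \<Rightarrow> ('x \<Rightarrow> real \<Rightarrow> real) \<Rightarrow> ('x \<Rightarrow> real \<Rightarrow> real) \<Rightarrow> bool" where
  "more_precise_at \<Theta> N P \<theta>0 H1 H2 \<longleftrightarrow>
     (\<forall>\<epsilon>>0. \<forall>\<nu>\<in>N \<theta>0.
        sto_le (P \<theta>0 \<nu>) (\<lambda>x. extend \<Theta> (H1 x) (\<theta>0 - \<epsilon>))
                        (\<lambda>x. extend \<Theta> (H2 x) (\<theta>0 - \<epsilon>)) \<and>
        sto_le (P \<theta>0 \<nu>) (\<lambda>x. 1 - extend \<Theta> (H1 x) (\<theta>0 + \<epsilon>))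
                        (\<lambda>x. 1 - extend \<Theta> (H2 x) (\<theta>0 + \<epsilon>)))"

text \<open>
  Tests are test functions \<open>\<phi>\<close>, where \<open>\<phi> x \<in> [0,1]\<close> is the probability of rejecting \<open>K0\<close> on
  observing \<open>x\<close>. The nonrandomized ones are the indicators of rejection regions. As usual, a
  UMPU test is compared with all unbiased tests, including the randomized ones.
\<close>

definition unbiased_test ::
  "'x measure \<Rightarrow> (real \<Rightarrow> 'n set) \<Rightarrow> (real \<Rightarrow> 'n \<Rightarrow> 'x measure) \<Rightarrow> real set \<Rightarrow> real set
     \<Rightarrow> real \<Rightarrow> ('x \<Rightarrow> real) \<Rightarrow> bool" where
  "unbiased_test S N P K0 K1 \<alpha> \<phi> \<longleftrightarrow>
     \<phi> \<in> borel_measurable S \<and> (\<forall>x\<in>space S. \<phi> x \<in> {0..1}) \<and>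
     (\<forall>\<theta>\<in>K0. \<forall>\<nu>\<in>N \<theta>. (\<integral>x. \<phi> x \<partial>P \<theta> \<nu>) \<le> \<alpha>) \<and>
     (\<forall>\<theta>\<in>K1. \<forall>\<nu>\<in>N \<theta>. (\<integral>x. \<phi> x \<partial>P \<theta> \<nu>) \<ge> \<alpha>)"

definition UMPU_test ::
  "'x measure \<Rightarrow> (real \<Rightarrow> 'n set) \<Rightarrow> (real \<Rightarrow> 'n \<Rightarrow> 'x measure) \<Rightarrow> real set \<Rightarrow> real set
     \<Rightarrow> real \<Rightarrow> ('x \<Rightarrow> real) \<Rightarrow> bool" where
  "UMPU_test S N P K0 K1 \<alpha> \<phi> \<longleftrightarrow>
     unbiased_test S N P K0 K1 \<alpha> \<phi> \<and>
     (\<forall>\<psi>. unbiased_test S N P K0 K1 \<alpha> \<psi> \<longrightarrow>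
        (\<forall>\<theta>\<in>K1. \<forall>\<nu>\<in>N \<theta>. (\<integral>x. \<phi> x \<partial>P \<theta> \<nu>) \<ge> (\<integral>x. \<psi> x \<partial>P \<theta> \<nu>)))"

text \<open>
  \<open>R \<alpha>\<close> is the rejection region at level \<open>\<alpha>\<close>. The infimum is taken in \<open>[0,1]\<close>: it is 1 if
  \<open>K0\<close> is rejected at no level.
\<close>

definition p_value :: "(real \<Rightarrow> 'x set) \<Rightarrow> 'x \<Rightarrow> real" where
  "p_value R x = Inf (insert 1 {\<alpha> \<in> {0<..<1}. x \<in> R \<alpha>})"

definition UMPU_p_value ::
  "'x measure \<Rightarrow> (real \<Rightarrow> 'n set) \<Rightarrow> (real \<Rightarrow> 'n \<Rightarrow> 'x measure) \<Rightarrow> real set \<Rightarrow> real set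
     \<Rightarrow> ('x \<Rightarrow> real) \<Rightarrow> bool" where
  "UMPU_p_value S N P K0 K1 q \<longleftrightarrow>
     (\<exists>R. (\<forall>\<alpha>\<in>{0<..<1}. R \<alpha> \<in> sets S \<and> UMPU_test S N P K0 K1 \<alpha> (indicator (R \<alpha>))) \<and>
          (\<forall>x\<in>space S. q x = p_value R x))"

end

theory Submission
  imports Defs
begin

text \<open>
  For a confidence distribution \<open>H\<close>, rejecting when \<open>H(\<theta>\<^sub>1) \<le> s\<close> is an unbiased level-\<open>s\<close> test of
  \<open>\<theta> \<le> \<theta>\<^sub>1\<close> against \<open>\<theta> > \<theta>\<^sub>1\<close>: its rejection probability is \<open>P(H(\<theta>\<^sub>1) \<le> s)\<close>, which compares with
  \<open>P(H(\<theta>) \<le> s) = s\<close> because \<open>H\<close> is nondecreasing. The UMPU test of level \<open>s\<close> rejects only if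
  \<open>p(\<theta>\<^sub>1) \<le> s\<close>, so its optimality gives \<open>P(H(\<theta>\<^sub>1) \<le> s) \<le> P(p(\<theta>\<^sub>1) \<le> s)\<close> for every true value
  \<open>\<theta> > \<theta>\<^sub>1\<close>. The other tail is the same argument applied to \<open>1 - H\<close>.
\<close>

section \<open>Tail probabilities of a uniform pivot\<close>

lemma has_U01_measure:
  assumes "has_U01 Q Y" "A \<in> sets borel"
  shows "measure Q {x \<in> space Q. Y x \<in> A} = measure lborel ({0..1} \<inter> A)"
proof -
  have "measure Q {x \<in> space Q. Y x \<in> A} = measure (distr Q borel Y) A"
    using assms unfolding has_U01_def
    by (subst measure_distr) (auto intro!: arg_cong[where f = "measure Q"])
  also have "\<dots> = measure (uniform_measure lborel {0..1}) A"
    using assms by (simp add: has_U01_def)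
  also have "\<dots> = measure lborel ({0..1} \<inter> A)"
    using assms by (subst measure_uniform_measure) auto
  finally show ?thesis .
qed

lemma has_U01_prob_le:
  assumes "has_U01 Q Y" "s \<in> {0<..<1}"
  shows "measure Q {x \<in> space Q. Y x \<le> s} = s"
proof -
  have "{0..1} \<inter> {..s} = {0..s}"
    using assms(2) by auto
  then show ?thesis
    using has_U01_measure[OF assms(1), of "{..s}"] assms(2) by simp
qed

text \<open>The reflection of a uniform variable is again uniform. This supplies the exact level of
  the tests that reject for large values of a confidence distribution.\<close>

lemma has_U01_prob_ge:
  assumes "has_U01 Q Y" "s \<in> {0<..<1}"
  shows "measure Q {x \<in> space Q. 1 - Y x \<le> s} = s"
proof -
  have "{0..1} \<inter> {1 - s..} = {1 - s..1}"
    using assms(2) by auto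
  moreover have "{x \<in> space Q. 1 - Y x \<le> s} = {x \<in> space Q. Y x \<in> {1 - s..}}"
    by auto
  ultimately show ?thesis
    using has_U01_measure[OF assms(1), of "{1 - s..}"] assms(2) by simp
qed

section \<open>Continuous distribution functions on an interval\<close>

lemma continuous_cdf_on_mono:
  assumes "continuous_cdf_on \<Theta> F"
  shows "mono_on \<Theta> F"
proof -
  obtain \<mu> where \<mu>: "real_distribution \<mu>" "extend \<Theta> F = cdf \<mu>"
    using assms by (auto simp: continuous_cdf_on_def)
  interpret real_distribution \<mu> by fact
  have eq: "F t = cdf \<mu> t" if "t \<in> \<Theta>" for t
    using that fun_cong[OF \<mu>(2), of t] by (simp add: extend_def)
  show ?thesis
    by (auto intro!: mono_onI simp: eq cdf_nondecreasing)
qed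

lemma continuous_cdf_on_bounds:
  assumes "continuous_cdf_on \<Theta> F" "t \<in> \<Theta>"
  shows "F t \<in> {0..1}"
proof -
  obtain \<mu> where \<mu>: "real_distribution \<mu>" "extend \<Theta> F = cdf \<mu>"
    using assms by (auto simp: continuous_cdf_on_def)
  interpret real_distribution \<mu> by fact
  have "F t = cdf \<mu> t"
    using assms(2) fun_cong[OF \<mu>(2), of t] by (simp add: extend_def)
  then show ?thesis
    using cdf_nonneg cdf_bounded_prob by auto
qed

text \<open>\<open>F\<close> is the cdf of the image of the uniform distribution on \<open>(0,1)\<close> under the inverse of \<open>F\<close>.\<close>

lemma continuous_cdf_onI:
  assumes \<Theta>: "is_interval \<Theta>"
    and F: "strict_mono_on \<Theta> F" "continuous_on \<Theta> F"
    and range: "{0<..<1} \<subseteq> F ` \<Theta>" "F ` \<Theta> \<subseteq> {0..1}"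
  shows "continuous_cdf_on \<Theta> F"
proof -
  define g where "g = inv_into \<Theta> F"
  \<comment> \<open>The endpoints are left out because \<open>F\<close> need not attain 0 and 1; on
    the open interval \<open>g\<close> is a true right inverse of \<open>F\<close>.\<close>
  define M where "M = restrict_space lborel {0<..<1::real}"
  have spM: "space M = {0<..<1}"
    by (simp add: M_def space_restrict_space)
  have M_eq: "measure M A = measure lborel A" if "A \<subseteq> {0<..<1}" for A
    using that unfolding M_def by (subst measure_restrict_space) auto
  have "emeasure M (space M) = 1"
    unfolding spM unfolding M_def by (subst emeasure_restrict_space) auto
  then interpret M: prob_space M
    by (rule prob_spaceI)
  have gin: "g u \<in> \<Theta>" and Fg: "F (g u) = u" if "u \<in> {0<..<1}" for u
    using that range(1) unfolding g_def by (meson inv_into_into f_inv_into_f subsetD)+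
  \<comment> \<open>Strict monotonicity gives both directions: \<open>g u \<le> t\<close> yields
    \<open>u = F (g u) \<le> F t\<close>, while \<open>t < g u\<close> yields
    \<open>F t < u\<close>.\<close>
  have g_le: "g u \<le> t \<longleftrightarrow> u \<le> F t" if "u \<in> {0<..<1}" "t \<in> \<Theta>" for u t
    using strict_mono_on_leD[OF F(1) gin[OF that(1)] that(2)]
      strict_mono_onD[OF F(1) that(2) gin[OF that(1)]] Fg[OF that(1)] by force
  have left: "{u \<in> space M. g u \<le> t} = {}" if "\<forall>\<theta>\<in>\<Theta>. t < \<theta>" for t
    using that gin by (force simp: spM)
  have right: "{u \<in> space M. g u \<le> t} = {0<..<1}" if t: "t \<notin> \<Theta>" "\<theta> \<in> \<Theta>" "\<not> t < \<theta>" for t \<theta>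
  proof -
    have "g u \<le> t" if "u \<in> {0<..<1}" for u
    proof (rule ccontr)
      \<comment> \<open>Otherwise \<open>t\<close> would lie between the points
        \<open>\<theta>\<close> and \<open>g u\<close> of the interval.\<close>
      assume "\<not> g u \<le> t"
      then have "t \<in> \<Theta>"
        using \<Theta> t(2,3) gin[OF that] unfolding is_interval_1 by (metis linorder_not_le order_less_imp_le)
      with t(1) show False by simp
    qed
    then show ?thesis by (auto simp: spM)
  qed
  have inside: "{u \<in> space M. g u \<le> t} = {0<..<1} \<inter> {..F t}" if "t \<in> \<Theta>" for t
    using g_le that by (auto simp: spM)
  have g_meas: "g \<in> borel_measurable M"
  proof (rule borel_measurableI_le)
    fix t
    \<comment> \<open>A sublevel set of \<open>g\<close> is an initial piece of the unit interval if
      \<open>t\<close> lies in \<open>\<Theta>\<close>, and otherwise empty or the whole space,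
      according to the side of \<open>\<Theta>\<close> on which \<open>t\<close> lies.\<close>
    show "{u \<in> space M. g u \<le> t} \<in> sets M"
    proof (cases "t \<in> \<Theta>")
      case True
      show ?thesis
        unfolding inside[OF True] unfolding M_def sets_restrict_space by (intro imageI) simp
    next
      case False
      then consider "{u \<in> space M. g u \<le> t} = {}" | "{u \<in> space M. g u \<le> t} = space M"
        using left[of t] right[of t] unfolding spM by blast
      then show ?thesis
        by cases (metis sets.empty_sets, metis sets.top)
    qed
  qed
  define \<mu> where "\<mu> = distr M borel g"
  interpret \<mu>: prob_space \<mu>
    unfolding \<mu>_def by (rule M.prob_space_distr[OF g_meas])
  have real: "real_distribution \<mu>"
    by unfold_locales (simp_all add: \<mu>_def)
  have "measure \<mu> \<Theta> = measure M (g -` \<Theta> \<inter> space M)"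
    unfolding \<mu>_def
    by (rule measure_distr[OF g_meas])
       (use \<Theta> in \<open>simp add: real_interval_borel_measurable\<close>)
  also have "g -` \<Theta> \<inter> space M = space M"
    using gin by (auto simp: spM)
  finally have "measure \<mu> \<Theta> = 1"
    by (simp add: M.prob_space)
  moreover have "extend \<Theta> F t = cdf \<mu> t" for t
  proof -
    have cdf: "cdf \<mu> t = measure M {u \<in> space M. g u \<le> t}"
      unfolding cdf_def \<mu>_def
      by (subst measure_distr[OF g_meas]) (auto intro!: arg_cong[where f = "measure M"])
    show ?thesis
    proof (cases "t \<in> \<Theta>")
      case True
      then have bd: "0 \<le> F t" "F t \<le> 1"
        using range(2) by auto
      \<comment> \<open>The intersection is half-open, ending in \<open>F t\<close>, except when
        \<open>F t = 1\<close>, where the right endpoint is missing; the length is the same.\<close>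
      have "measure lborel ({0<..<1} \<inter> {..F t}) = F t"
      proof (cases "F t = 1")
        case True
        then have "{0<..<1} \<inter> {..F t} = {0<..<1}" by auto
        then show ?thesis using True by simp
      next
        case False
        then have "{0<..<1} \<inter> {..F t} = {0<..F t}" using bd by auto
        then show ?thesis using bd by simp
      qed
      then show ?thesis
        using True by (simp add: cdf inside M_eq extend_def)
    next
      case False
      show ?thesis
      proof (cases "\<forall>\<theta>\<in>\<Theta>. t < \<theta>")
        case True
        then show ?thesis
          unfolding cdf left[OF True] using False by (simp add: extend_def)
      next
        case not_left: False
        then have "{u \<in> space M. g u \<le> t} = space M"
          using right[OF False] unfolding spM by blast
        then show ?thesis
          unfolding cdf using False not_left by (simp add: extend_def M.prob_space)
      qed
    qed
  qed
  ultimately show ?thesis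
    using F(2) real unfolding continuous_cdf_on_def by blast
qed

section \<open>Tests built from pivots and the optimality of p-values\<close>

lemma p_value_le_1: "p_value R x \<le> 1"
  unfolding p_value_def by (rule cInf_lower) (auto intro!: bdd_belowI[of _ 0])

text \<open>Only this direction holds in general: the infimum may equal a level at which there is no
  rejection.\<close>

lemma p_value_le_level:
  assumes "\<alpha> \<in> {0<..<1}" "x \<in> R \<alpha>"
  shows "p_value R x \<le> \<alpha>"
  unfolding p_value_def using assms by (intro cInf_lower) (auto intro!: bdd_belowI[of _ 0])

text \<open>Under the true value \<open>\<theta>\<close> the event
  \<open>h \<theta> x \<le> s\<close> has probability exactly \<open>s\<close>. By the pointwise
  order it contains the rejection event on \<open>K0\<close> and is contained in it on
  \<open>K1\<close>. Since the order enters only through \<open>K0\<close> and \<open>K1\<close>,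
  the lemma serves both an increasing pivot \<open>H\<close> and the decreasing pivot
  \<open>1 - H\<close>.\<close>

lemma unbiased_test_pivot:
  assumes prob: "\<And>\<theta> \<nu>. \<theta> \<in> K0 \<union> K1 \<Longrightarrow> \<nu> \<in> N \<theta> \<Longrightarrow>
      prob_space (P \<theta> \<nu>) \<and> sets (P \<theta> \<nu>) = sets S"
    and meas: "\<And>\<theta>. \<theta> \<in> insert \<theta>1 (K0 \<union> K1) \<Longrightarrow> h \<theta> \<in> borel_measurable S"
    and level: "\<And>\<theta> \<nu>. \<theta> \<in> K0 \<union> K1 \<Longrightarrow> \<nu> \<in> N \<theta> \<Longrightarrow>
      measure (P \<theta> \<nu>) {x \<in> space (P \<theta> \<nu>). h \<theta> x \<le> s} = s"
    and K0: "\<And>\<theta> x. \<theta> \<in> K0 \<Longrightarrow> x \<in> space S \<Longrightarrow> h \<theta> x \<le> h \<theta>1 x"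
    and K1: "\<And>\<theta> x. \<theta> \<in> K1 \<Longrightarrow> x \<in> space S \<Longrightarrow> h \<theta>1 x \<le> h \<theta> x"
  shows "unbiased_test S N P K0 K1 s (indicator {x \<in> space S. h \<theta>1 x \<le> s})"
proof -
  let ?A = "\<lambda>\<theta>. {x \<in> space S. h \<theta> x \<le> s}"
  have A: "?A \<theta> \<in> sets S" if "\<theta> \<in> insert \<theta>1 (K0 \<union> K1)" for \<theta>
    using meas[OF that] by measurable
  have int: "(\<integral>x. indicator (?A \<theta>1) x \<partial>P \<theta> \<nu>) = measure (P \<theta> \<nu>) (?A \<theta>1)"
    and s: "measure (P \<theta> \<nu>) (?A \<theta>) = s"
    and mono: "\<And>B C. B \<in> sets S \<Longrightarrow> C \<in> sets S \<Longrightarrow> B \<subseteq> C \<Longrightarrow> measure (P \<theta> \<nu>) B \<le> measure (P \<theta> \<nu>) C"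
    if "\<theta> \<in> K0 \<union> K1" "\<nu> \<in> N \<theta>" for \<theta> \<nu>
  proof -
    interpret prob_space "P \<theta> \<nu>"
      using prob[OF that] by simp
    have sets: "sets (P \<theta> \<nu>) = sets S"
      using prob[OF that] by simp
    note sp = sets_eq_imp_space_eq[OF sets]
    show "(\<integral>x. indicator (?A \<theta>1) x \<partial>P \<theta> \<nu>) = measure (P \<theta> \<nu>) (?A \<theta>1)"
      by (simp add: sp Int_absorb2 Collect_restrict)
    show "measure (P \<theta> \<nu>) (?A \<theta>) = s"
      using level[OF that] by (simp add: sp)
    show "measure (P \<theta> \<nu>) B \<le> measure (P \<theta> \<nu>) C" if "B \<in> sets S" "C \<in> sets S" "B \<subseteq> C" for B C
      using that by (intro finite_measure_mono) (simp_all add: sets)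
  qed
  have "measure (P \<theta> \<nu>) (?A \<theta>1) \<le> s" if "\<theta> \<in> K0" "\<nu> \<in> N \<theta>" for \<theta> \<nu>
    using mono[of \<theta> \<nu> "?A \<theta>1" "?A \<theta>"] A[of \<theta>] A[of \<theta>1] s[of \<theta> \<nu>] K0[OF that(1)] that
    by (fastforce intro: order_trans)
  moreover have "s \<le> measure (P \<theta> \<nu>) (?A \<theta>1)" if "\<theta> \<in> K1" "\<nu> \<in> N \<theta>" for \<theta> \<nu>
    using mono[of \<theta> \<nu> "?A \<theta>" "?A \<theta>1"] A[of \<theta>] A[of \<theta>1] s[of \<theta> \<nu>] K1[OF that(1)] that
    by (fastforce intro: order_trans)
  ultimately show ?thesis
    unfolding unbiased_test_def using A[of \<theta>1] int
    by (auto simp: indicator_def[abs_def] intro: borel_measurable_indicator)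
qed

text \<open>Optimality speaks only about levels strictly between 0 and 1. The other thresholds need
  separate reasons: below 0 the event for \<open>h\<close> is empty, from 1 on the event for
  \<open>q\<close> is certain because a p-value is at most 1, and the threshold 0 is reached as a
  limit of positive levels.\<close>

lemma UMPU_p_value_sto_le:
  assumes q: "UMPU_p_value S N P K0 K1 q"
    and unb: "\<And>s. s \<in> {0<..<1} \<Longrightarrow> unbiased_test S N P K0 K1 s (indicator {x \<in> space S. h x \<le> s})"
    and h: "\<And>x. x \<in> space S \<Longrightarrow> 0 \<le> h x"
    and meas: "q \<in> borel_measurable S" "h \<in> borel_measurable S"
    and \<theta>: "\<theta> \<in> K1" "\<nu> \<in> N \<theta>"
    and prob: "prob_space (P \<theta> \<nu>)" and sets: "sets (P \<theta> \<nu>) = sets S"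
  shows "sto_le (P \<theta> \<nu>) q h"
proof -
  obtain R where R: "\<And>\<alpha>. \<alpha> \<in> {0<..<1} \<Longrightarrow> R \<alpha> \<in> sets S"
      "\<And>\<alpha>. \<alpha> \<in> {0<..<1} \<Longrightarrow> UMPU_test S N P K0 K1 \<alpha> (indicator (R \<alpha>))"
      "\<And>x. x \<in> space S \<Longrightarrow> q x = p_value R x"
    using q unfolding UMPU_p_value_def by blast
  let ?Q = "P \<theta> \<nu>"
  interpret prob_space ?Q by fact
  note sp = sets_eq_imp_space_eq[OF sets]
  have le_sets: "{x \<in> space S. q x \<le> s} \<in> sets S" "{x \<in> space S. h x \<le> s} \<in> sets S" for s
    using meas by measurable
  have mid: "prob {x \<in> space S. h x \<le> s} \<le> prob {x \<in> space S. q x \<le> s}"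
    if s: "s \<in> {0<..<1}" for s
  proof -
    have "(\<integral>x. indicator {x \<in> space S. h x \<le> s} x \<partial>?Q) \<le> (\<integral>x. indicator (R s) x \<partial>?Q :: real)"
      using R(2)[OF s] unb[OF s] \<theta> unfolding UMPU_test_def by blast
    then have "prob {x \<in> space S. h x \<le> s} \<le> prob (R s)"
      using sets.sets_into_space[OF R(1)[OF s]] by (simp add: sp Int_absorb2 Collect_restrict)
    also have "\<dots> \<le> prob {x \<in> space S. q x \<le> s}"
      using sets.sets_into_space[OF R(1)[OF s]] p_value_le_level[OF s, of _ R] R(3) le_sets
      by (intro finite_measure_mono) (auto simp: sets)
    finally show ?thesis .
  qed
  have zero: "prob {x \<in> space S. h x \<le> 0} \<le> prob {x \<in> space S. q x \<le> 0}"
  proof -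
    \<comment> \<open>The shift by 2 keeps every \<open>e n\<close> below 1, hence an admissible
      level. The limit is needed on the side of \<open>q\<close> only; for \<open>h\<close>, the
      event at 0 is contained in the event at \<open>e n\<close>.\<close>
    define e where "e n = inverse (real (n + 2))" for n
    have e: "e n \<in> {0<..<1}" for n
      by (auto simp: e_def field_simps)
    have "decseq e"
      by (auto simp: decseq_def e_def field_simps)
    have e0: "e \<longlonglongrightarrow> 0"
      unfolding e_def by real_asymp
    have "(\<lambda>n. prob {x \<in> space S. q x \<le> e n}) \<longlonglongrightarrow> prob (\<Inter>n. {x \<in> space S. q x \<le> e n})"
      using \<open>decseq e\<close> le_sets
      by (intro finite_Lim_measure_decseq) (auto simp: decseq_def sets intro: order_trans)
    moreover have "(\<Inter>n. {x \<in> space S. q x \<le> e n}) = {x \<in> space S. q x \<le> 0}"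
      using e order_trans[OF _ less_imp_le] LIMSEQ_le_const[OF e0] by fastforce
    moreover have "prob {x \<in> space S. h x \<le> 0} \<le> prob {x \<in> space S. q x \<le> e n}" for n
    proof -
      have "prob {x \<in> space S. h x \<le> 0} \<le> prob {x \<in> space S. h x \<le> e n}"
        using e[of n] le_sets by (intro finite_measure_mono) (auto simp: sets)
      with mid[OF e[of n]] show ?thesis by simp
    qed
    ultimately show ?thesis
      by (metis (no_types, lifting) LIMSEQ_le_const)
  qed
  have "prob {x \<in> space S. h x \<le> s} \<le> prob {x \<in> space S. q x \<le> s}" for s
  proof -
    consider "s < 0" | "s = 0" | "s \<in> {0<..<1}" | "s \<ge> 1" by fastforce
    then show ?thesis
    proof cases
      case 1
      then have none: "{x \<in> space S. h x \<le> s} = {}" using h by force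
      show ?thesis unfolding none by simp
    next
      case 4
      then have all: "{x \<in> space S. q x \<le> s} = space ?Q"
        using R(3) order_trans[OF p_value_le_1[of R]] by (auto simp: sp)
      show ?thesis unfolding all by (simp add: prob_space)
    qed (use zero mid in auto)
  qed
  then show ?thesis
    unfolding sto_le_def sp by simp
qed

section \<open>Precision of the p-value as a confidence distribution\<close>

theorem theorem2p2:
  fixes S :: "'x measure" and \<Theta> :: "real set" and N :: "real \<Rightarrow> 'n set"
    and P :: "real \<Rightarrow> 'n \<Rightarrow> 'x measure" and p :: "'x \<Rightarrow> real \<Rightarrow> real"
  assumes "is_interval \<Theta>"
    and "\<And>\<theta>. \<theta> \<in> \<Theta> \<Longrightarrow> N \<theta> \<noteq> {}"
    and "\<And>\<theta> \<nu>. \<theta> \<in> \<Theta> \<Longrightarrow> \<nu> \<in> N \<theta> \<Longrightarrow> prob_space (P \<theta> \<nu>) \<and> sets (P \<theta> \<nu>) = sets S"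
    and "\<And>\<theta>0. \<theta>0 \<in> \<Theta> \<Longrightarrow>
           UMPU_p_value S N P {\<theta>\<in>\<Theta>. \<theta> \<le> \<theta>0} {\<theta>\<in>\<Theta>. \<theta> > \<theta>0} (\<lambda>x. p x \<theta>0)"
    and "\<And>x. x \<in> space S \<Longrightarrow>
           strict_mono_on \<Theta> (p x) \<and> continuous_on \<Theta> (p x) \<and>
           {0<..<1} \<subseteq> p x ` \<Theta> \<and> p x ` \<Theta> \<subseteq> {0..1}"
    and "\<And>\<theta>0. \<theta>0 \<in> \<Theta> \<Longrightarrow>
           UMPU_p_value S N P {\<theta>\<in>\<Theta>. \<theta> \<ge> \<theta>0} {\<theta>\<in>\<Theta>. \<theta> < \<theta>0} (\<lambda>x. 1 - p x \<theta>0)"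
    and "\<And>\<theta>0 \<nu>. \<theta>0 \<in> \<Theta> \<Longrightarrow> \<nu> \<in> N \<theta>0 \<Longrightarrow> has_U01 (P \<theta>0 \<nu>) (\<lambda>x. p x \<theta>0)"
  shows "confidence_distribution S \<Theta> N P p \<and>
         (\<forall>H. confidence_distribution S \<Theta> N P H \<longrightarrow>
            (\<forall>\<theta>0\<in>\<Theta>. more_precise_at \<Theta> N P \<theta>0 p H))"
proof (intro conjI allI impI ballI)
  note prob = assms(3)
  \<comment> \<open>A confidence distribution is measurable by definition only with respect to
    \<open>P \<theta> \<nu>\<close>. Some nuisance value exists, and the sets of
    \<open>P \<theta> \<nu>\<close> are those of \<open>S\<close>.\<close>
  have meas: "(\<lambda>x. H x \<theta>) \<in> borel_measurable S"
    if "confidence_distribution S \<Theta> N P H" "\<theta> \<in> \<Theta>" for H \<theta>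
  proof -
    obtain \<nu> where \<nu>: "\<nu> \<in> N \<theta>" using assms(2) \<open>\<theta> \<in> \<Theta>\<close> by blast
    then have "(\<lambda>x. H x \<theta>) \<in> borel_measurable (P \<theta> \<nu>)"
      using that by (auto simp: confidence_distribution_def has_U01_def)
    then show ?thesis
      using measurable_cong_sets[of "P \<theta> \<nu>" S borel borel] prob[OF \<open>\<theta> \<in> \<Theta>\<close> \<nu>] by blast
  qed
  show p: "confidence_distribution S \<Theta> N P p"
    using continuous_cdf_onI[OF assms(1)] assms(5,7) by (simp add: confidence_distribution_def)
  fix H \<theta>0 assume H: "confidence_distribution S \<Theta> N P H" and \<theta>0: "\<theta>0 \<in> \<Theta>"
  have cdf: "continuous_cdf_on \<Theta> (H x)" if "x \<in> space S" for x
    using H that by (simp add: confidence_distribution_def)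
  have U: "has_U01 (P \<theta> \<nu>) (\<lambda>x. H x \<theta>)" if "\<theta> \<in> \<Theta>" "\<nu> \<in> N \<theta>" for \<theta> \<nu>
    using H that by (simp add: confidence_distribution_def)
  have mono: "H x s \<le> H x t" if "x \<in> space S" "s \<in> \<Theta>" "t \<in> \<Theta>" "s \<le> t" for x s t
    using mono_onD[OF continuous_cdf_on_mono[OF cdf]] that by blast
  have bounds: "0 \<le> H x t" "H x t \<le> 1" if "x \<in> space S" "t \<in> \<Theta>" for x t
    using continuous_cdf_on_bounds[OF cdf] that by auto
  \<comment> \<open>Here \<open>\<theta>1\<close> plays the role of
    \<open>\<theta>0 - \<epsilon>\<close>, so that the true value \<open>\<theta>0\<close> lies in
    the alternative, where the UMPU tests maximize power.\<close>
  have lower: "sto_le (P \<theta>0 \<nu>) (\<lambda>x. p x \<theta>1) (\<lambda>x. H x \<theta>1)"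
    if \<theta>1: "\<theta>1 \<in> \<Theta>" "\<theta>1 < \<theta>0" and \<nu>: "\<nu> \<in> N \<theta>0" for \<theta>1 \<nu>
  proof (rule UMPU_p_value_sto_le[OF assms(4)[OF \<theta>1(1)]])
    fix s :: real assume "s \<in> {0<..<1}"
    then show "unbiased_test S N P {\<theta> \<in> \<Theta>. \<theta> \<le> \<theta>1} {\<theta> \<in> \<Theta>. \<theta> > \<theta>1} s
        (indicator {x \<in> space S. H x \<theta>1 \<le> s})"
      using prob meas[OF H] has_U01_prob_le[OF U] mono \<theta>1
      by (intro unbiased_test_pivot[where h = "\<lambda>\<theta> x. H x \<theta>"]) auto
  qed (use meas[OF H] meas[OF p] bounds \<theta>0 \<theta>1 \<nu> prob in auto)
  \<comment> \<open>The mirror image: with \<open>\<theta>1\<close> to the right of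
    \<open>\<theta>0\<close>, the true value lies in the alternative of the reversed problem, whose
    p-value is \<open>1 - p\<close>.\<close>
  have upper: "sto_le (P \<theta>0 \<nu>) (\<lambda>x. 1 - p x \<theta>1) (\<lambda>x. 1 - H x \<theta>1)"
    if \<theta>1: "\<theta>1 \<in> \<Theta>" "\<theta>0 < \<theta>1" and \<nu>: "\<nu> \<in> N \<theta>0" for \<theta>1 \<nu>
  proof (rule UMPU_p_value_sto_le[OF assms(6)[OF \<theta>1(1)]])
    fix s :: real assume "s \<in> {0<..<1}"
    then show "unbiased_test S N P {\<theta> \<in> \<Theta>. \<theta> \<ge> \<theta>1} {\<theta> \<in> \<Theta>. \<theta> < \<theta>1} s
        (indicator {x \<in> space S. 1 - H x \<theta>1 \<le> s})"
      using prob meas[OF H] has_U01_prob_ge[OF U] mono \<theta>1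
      by (intro unbiased_test_pivot[where h = "\<lambda>\<theta> x. 1 - H x \<theta>"]) auto
  qed (use meas[OF H] meas[OF p] bounds \<theta>0 \<theta>1 \<nu> prob in auto)
  show "more_precise_at \<Theta> N P \<theta>0 p H"
    unfolding more_precise_at_def
  proof (intro allI impI ballI conjI)
    fix \<epsilon> :: real and \<nu> assume "\<epsilon> > 0" and \<nu>: "\<nu> \<in> N \<theta>0"
    \<comment> \<open>If the shifted point leaves \<open>\<Theta>\<close>, both extensions equal the
      same constant, which depends on \<open>\<Theta>\<close> alone, and the comparison is
      trivial.\<close>
    show "sto_le (P \<theta>0 \<nu>) (\<lambda>x. extend \<Theta> (p x) (\<theta>0 - \<epsilon>)) (\<lambda>x. extend \<Theta> (H x) (\<theta>0 - \<epsilon>))"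
      using lower[OF _ _ \<nu>, of "\<theta>0 - \<epsilon>"] \<open>\<epsilon> > 0\<close>
      by (cases "\<theta>0 - \<epsilon> \<in> \<Theta>") (simp_all add: extend_def sto_le_def)
    show "sto_le (P \<theta>0 \<nu>) (\<lambda>x. 1 - extend \<Theta> (p x) (\<theta>0 + \<epsilon>))
        (\<lambda>x. 1 - extend \<Theta> (H x) (\<theta>0 + \<epsilon>))"
      using upper[OF _ _ \<nu>, of "\<theta>0 + \<epsilon>"] \<open>\<epsilon> > 0\<close>
      by (cases "\<theta>0 + \<epsilon> \<in> \<Theta>") (simp_all add: extend_def sto_le_def)
  qed
qed

end
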